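(* For all integers $n\geq m\geq 3$, $$R(\mathcal{P}^3_n,\mathcal{C}^3_m)=2n+\Big\lfloor\frac{m+1}{2}\Big\rfloor .$$
   Context: The 3-uniform loose path $\mathcal{P}^3_n$ (of length $n$) is the hypergraph with vertex set $\{v_1,\dots,v_{2n+1}\}$ and the $n$ edges $\{v_{2i+1},v_{2i+2},v_{2i+3}\}$, $i=0,1,\dots,n-1$. The 3-uniform loose cycle $\mathcal{C}^3_m$ (of length $m$) is the hypergraph with vertex set $\{v_1,\dots,v_{2m}\}$ and the $m$ edges $\{v_{2i+1},v_{2i+2},v_{2i+3}\}$, $i=0,1,\dots,m-1$, subscripts taken modulo $2m$. For 3-uniform hypergraphs $\mathcal{H},\mathcal{G}$, the Ramsey number $R(\mathcal{H},\mathcal{G})$ is the smallest $N$ such that every red-blue coloring of the edges of the complete 3-uniform hypergraph $\mathcal{K}^3_N$ on $N$ vertices contains a red copy of $\mathcal{H}$ or a blue copy of $\mathcal{G}$ (copies are not necessarily induced). *)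

theory Defs
  imports "HOL-Library.Ramsey"
begin

record 'a hypergraph =
  verts :: "'a set"
  edges :: "'a set set"

definition loose_path :: "nat \<Rightarrow> nat hypergraph" where
  "loose_path n =
    \<lparr>verts = {1..2*n+1},
     edges = (\<lambda>i. {2*i+1, 2*i+2, 2*i+3}) ` {..<n}\<rparr>"

text \<open>
  The vertex \<open>v\<^sub>k\<close> is represented by the residue \<open>k mod 2m\<close>, so \<open>v\<^sub>2\<^sub>m\<close> is \<open>0\<close>.
\<close>

definition loose_cycle :: "nat \<Rightarrow> nat hypergraph" where
  "loose_cycle m =
    \<lparr>verts = {..<2*m},
     edges = (\<lambda>i. {(2*i+1) mod (2*m), (2*i+2) mod (2*m), (2*i+3) mod (2*m)}) ` {..<m}\<rparr>"

definition complete3 :: "nat \<Rightarrow> nat hypergraph" where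
  "complete3 N = \<lparr>verts = {..<N}, edges = [{..<N}]\<^bsup>3\<^esup>\<rparr>"

definition contains_copy :: "'b hypergraph \<Rightarrow> 'a hypergraph \<Rightarrow> bool" where
  "contains_copy K H \<longleftrightarrow>
    (\<exists>f. inj_on f (verts H) \<and> f ` verts H \<subseteq> verts K \<and> (\<forall>e\<in>edges H. f ` e \<in> edges K))"

datatype colour = Red | Blue

text \<open>A colouring is a total function; only its values on the edges are relevant.\<close>

definition colour_class :: "('a set \<Rightarrow> colour) \<Rightarrow> colour \<Rightarrow> 'a hypergraph \<Rightarrow> 'a hypergraph" where
  "colour_class c k K = \<lparr>verts = verts K, edges = {e \<in> edges K. c e = k}\<rparr>"

definition arrows :: "nat \<Rightarrow> 'a hypergraph \<Rightarrow> 'b hypergraph \<Rightarrow> bool" where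
  "arrows N H G \<longleftrightarrow>
    (\<forall>c. contains_copy (colour_class c Red (complete3 N)) H \<or>
         contains_copy (colour_class c Blue (complete3 N)) G)"

definition ramsey_number :: "'a hypergraph \<Rightarrow> 'b hypergraph \<Rightarrow> nat" where
  "ramsey_number H G = (LEAST N. arrows N H G)"

definition uniform3 :: "'a hypergraph \<Rightarrow> bool" where
  "uniform3 H \<longleftrightarrow> finite (verts H) \<and> edges H \<subseteq> [verts H]\<^bsup>3\<^esup>"

lemma uniform3_loose_path: "uniform3 (loose_path n)"
  by (auto simp: uniform3_def loose_path_def nsets_def)

lemma uniform3_loose_cycle:
  assumes "m \<ge> 2"
  shows "uniform3 (loose_cycle m)"
proof -
  have "card {(2*i+1) mod (2*m), (2*i+2) mod (2*m), (2*i+3) mod (2*m)} = 3" if "i < m" for i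
  proof (cases "i = m - 1")
    case True
    then have i: "2*i+2 = 2*m" "2*i+3 = Suc (2*m)"
      using assms by auto
    have "(2*i+1) mod (2*m) = 2*i+1"
      by (rule mod_less) (use that in linarith)
    moreover have "(2*i+2) mod (2*m) = 0" "(2*i+3) mod (2*m) = 1"
      unfolding i using assms by (simp_all add: mod_Suc)
    moreover have "i \<noteq> 0" using i assms by auto
    ultimately show ?thesis by simp
  next
    case False
    then have "2*i+3 < 2*m" using that by auto
    then show ?thesis by auto
  qed
  then show ?thesis
    using assms by (auto simp: uniform3_def loose_cycle_def nsets_def)
qed

lemma contains_copy_clique:
  assumes H: "uniform3 H" and S: "S \<subseteq> verts K" "finite S" "card S = card (verts H)"
    and mono: "[S]\<^bsup>3\<^esup> \<subseteq> edges K"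
  shows "contains_copy K H"
proof -
  obtain f where f: "bij_betw f (verts H) S"
    using H S finite_same_card_bij[of "verts H" S] by (auto simp: uniform3_def)
  have "f ` e \<in> edges K" if "e \<in> edges H" for e
  proof -
    have e: "e \<subseteq> verts H" "finite e" "card e = 3"
      using H that by (auto simp: uniform3_def nsets_def)
    have "inj_on f e" using f e by (meson bij_betw_def inj_on_subset)
    then have "f ` e \<in> [S]\<^bsup>3\<^esup>"
      using f e by (auto simp: nsets_def card_image bij_betw_def)
    then show ?thesis using mono by blast
  qed
  then show ?thesis
    using f S unfolding contains_copy_def bij_betw_def by blast
qed

text \<open>By Ramsey's theorem the minimum in the definition of the Ramsey number is attained.\<close>

lemma arrows_ramsey_number:
  assumes H: "uniform3 H" and G: "uniform3 G"
  shows "arrows (ramsey_number H G) H G"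
proof -
  obtain N :: nat where N: "partn_lst {..<N} [card (verts H), card (verts G)] 3"
    using ramsey_full by blast
  have "arrows N H G"
    unfolding arrows_def
  proof
    fix c :: "nat set \<Rightarrow> colour"
    define f where "f e = (if c e = Red then 0 else 1::nat)" for e
    have "f \<in> [{..<N}]\<^bsup>3\<^esup> \<rightarrow> {..<length [card (verts H), card (verts G)]}"
      by (auto simp: f_def)
    then obtain i where i: "i < 2"
      and "monochromatic {..<N} ([card (verts H), card (verts G)] ! i) 3 f i"
      using N by (auto simp: partn_lst_def numeral_2_eq_2)
    then obtain S where S: "S \<subseteq> {..<N}" "finite S"
        "card S = [card (verts H), card (verts G)] ! i" "f ` [S]\<^bsup>3\<^esup> \<subseteq> {i}"
      by (auto simp: monochromatic_def nsets_def)
    have sub: "[S]\<^bsup>3\<^esup> \<subseteq> [{..<N}]\<^bsup>3\<^esup>"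
      using S by (intro nsets_mono)
    consider "i = 0" | "i = 1" using i by linarith
    then show "contains_copy (colour_class c Red (complete3 N)) H \<or>
         contains_copy (colour_class c Blue (complete3 N)) G"
    proof cases
      case 1
      have "c e = Red" if "e \<in> [S]\<^bsup>3\<^esup>" for e
        using S(4) that 1 by (auto simp: f_def image_subset_iff split: if_splits)
      then have "contains_copy (colour_class c Red (complete3 N)) H"
        using S sub 1 by (intro contains_copy_clique[OF H, of S])
          (auto simp: colour_class_def complete3_def)
      then show ?thesis ..
    next
      case 2
      have "c e = Blue" if "e \<in> [S]\<^bsup>3\<^esup>" for e
      proof -
        have "f e = 1" using S(4) that 2 by blast
        then show ?thesis by (cases "c e") (auto simp: f_def)
      qed
      then have "contains_copy (colour_class c Blue (complete3 N)) G"
        using S sub 2 by (intro contains_copy_clique[OF G, of S])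
          (auto simp: colour_class_def complete3_def)
      then show ?thesis ..
    qed
  qed
  then show ?thesis
    unfolding ramsey_number_def by (rule LeastI)
qed

end

theory Submission
  imports Defs
begin

text \<open>
  The lower bound comes from colouring a triple red iff it lies inside a fixed set of
  \<open>2n\<close> vertices: each of the other \<open>(m + 1) div 2 - 1\<close> vertices is on at most two edges of a
  blue cycle.

  For the upper bound, let \<open>W\<close> be the set of vertices outside a longest red path.
  Two consecutive edges \<open>abc, cde\<close> of the path cannot be replaced by three red edges from \<open>a\<close>
  to \<open>e\<close> using vertices of \<open>W\<close>. This forces a blue detour: for nearly all \<open>x, y \<in> W\<close>
  there are distinct \<open>p, q, r\<close> among \<open>a, \<dots>, e\<close> with \<open>xpq\<close> and \<open>qry\<close> blue. Detours of
  successive pairs of edges can be chosen disjoint, so \<open>k\<close> pairs give a blue path with \<open>2k\<close>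
  edges through \<open>k + 1\<close> vertices of \<open>W\<close>. It is closed to a blue \<open>m\<close>-cycle by edges
  \<open>wuw'\<close> with \<open>w, w' \<in> W\<close> and \<open>u\<close> one of the last two vertices at either end of the red path;
  these are blue, since otherwise the red path could be prolonged.

  Induction on \<open>n + m\<close> gives a red path with \<open>n - 1\<close> edges, except that for \<open>n = m\<close> it may
  give a blue cycle of length \<open>m - 1\<close>. The detour argument, applied to that cycle with the colours
  exchanged, then yields a red path with at least \<open>m - 2\<close> edges, which is long enough.
\<close>

section \<open>Loose paths and cycles as vertex lists\<close>

text \<open>Consecutive edges share the entry at an even position, so \<open>n\<close> edges take
  \<open>2 * n + 1\<close> entries. Distinctness is stated separately.\<close>

fun lpath :: "('a set \<Rightarrow> bool) \<Rightarrow> 'a list \<Rightarrow> bool" where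
  "lpath E (a # b # c # xs) \<longleftrightarrow> E {a, b, c} \<and> lpath E (c # xs)"
| "lpath E [a] \<longleftrightarrow> True"
| "lpath E [] \<longleftrightarrow> False"
| "lpath E [a, b] \<longleftrightarrow> False"

definition lcycle :: "('a set \<Rightarrow> bool) \<Rightarrow> 'a list \<Rightarrow> bool" where
  "lcycle E ys \<longleftrightarrow> ys \<noteq> [] \<and> lpath E (ys @ [hd ys])"

lemma lpath_odd: "lpath E xs \<Longrightarrow> odd (length xs)"
  by (induction E xs rule: lpath.induct) auto

text \<open>Edges meet only at even positions, so a path can be cut there; the vertex at the cut
  belongs to both parts.\<close>

lemma lpath_append:
  "even (length xs) \<Longrightarrow> lpath E (xs @ a # ys) \<longleftrightarrow> lpath E (xs @ [a]) \<and> lpath E (a # ys)"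
proof (induction xs rule: length_induct)
  case (1 xs)
  show ?case
  proof (cases xs)
    case Nil
    then show ?thesis by simp
  next
    case (Cons p xs1)
    then obtain q xs2 where xs: "xs = p # q # xs2"
      using 1(2) by (cases xs1) auto
    show ?thesis
    proof (cases xs2)
      case Nil
      then show ?thesis using xs by simp
    next
      case (Cons r xs3)
      then have "lpath E (xs2 @ a # ys) \<longleftrightarrow> lpath E (xs2 @ [a]) \<and> lpath E (a # ys)"
        using 1(1)[rule_format, of xs2] 1(2) xs by simp
      then show ?thesis using xs Cons by auto
    qed
  qed
qed

lemma lpath_rev: "lpath E xs \<Longrightarrow> lpath E (rev xs)"
proof (induction E xs rule: lpath.induct)
  case (1 E a b c xs)
  then have r: "lpath E (rev xs @ [c])" by simp
  then have "even (length (rev xs))" using lpath_odd by fastforce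
  then have "lpath E (rev xs @ c # [b, a]) \<longleftrightarrow> lpath E (rev xs @ [c]) \<and> lpath E (c # [b, a])"
    by (rule lpath_append)
  then show ?case using 1 r by (simp add: insert_commute)
qed auto

lemma lpath_nth:
  "lpath E xs \<Longrightarrow> 2 * i + 2 < length xs \<Longrightarrow> E {xs ! (2*i), xs ! (2*i+1), xs ! (2*i+2)}"
proof (induction E xs arbitrary: i rule: lpath.induct)
  case (1 E a b c xs)
  show ?case
  proof (cases i)
    case 0
    then show ?thesis using 1 by (simp add: numeral_2_eq_2)
  next
    case (Suc j)
    then show ?thesis using 1(1)[of j] 1(2,3) by (simp add: numeral_2_eq_2)
  qed
qed auto

section \<open>Blue detours around a red path that cannot be lengthened\<close>

text \<open>No rerouting through \<open>W\<close> between the same endpoints gains exactly one edge,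
  that is, two entries. Because the endpoints are fixed, the property passes to segments and can be
  used locally.\<close>

definition rigid :: "('a set \<Rightarrow> bool) \<Rightarrow> 'a set \<Rightarrow> 'a list \<Rightarrow> bool" where
  "rigid E W L \<longleftrightarrow> lpath E L \<and> distinct L \<and> set L \<inter> W = {} \<and>
    (\<forall>L'. lpath E L' \<longrightarrow> distinct L' \<longrightarrow> set L' \<subseteq> set L \<union> W \<longrightarrow> hd L' = hd L \<longrightarrow> last L' = last L
       \<longrightarrow> length L' \<noteq> length L + 2)"

lemma rigidD:
  assumes "rigid E W L" "distinct L'" "set L' \<subseteq> set L \<union> W" "hd L' = hd L"
    "last L' = last L" "length L' = length L + 2"
  shows "\<not> lpath E L'"
  using assms unfolding rigid_def by blast

lemma rigid_append:
  assumes "rigid E W (xs @ M)" "even (length xs)" "M \<noteq> []"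
  shows "rigid E W M"
  unfolding rigid_def
proof (intro conjI allI impI notI)
  obtain a M' where M: "M = a # M'" using assms(3) by (cases M) auto
  have *: "lpath E (xs @ [a])" "lpath E (a # M')"
    using assms(1) lpath_append[OF assms(2), of E a M'] unfolding rigid_def M by auto
  show "lpath E M" using * M by simp
  show "distinct M" "set M \<inter> W = {}"
    using assms unfolding rigid_def by auto
  fix L' assume L': "lpath E L'" "distinct L'" "set L' \<subseteq> set M \<union> W" "hd L' = hd M"
    "last L' = last M" "length L' = length M + 2"
  then obtain zs where zs: "L' = a # zs" using M by (cases L') auto
  have "\<not> lpath E (xs @ L')"
  proof (rule rigidD[OF assms(1)])
    show "distinct (xs @ L')" using assms(1) L' unfolding rigid_def by auto
  qed (use L' M zs in \<open>auto simp: hd_append\<close>)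
  moreover have "lpath E (xs @ L')"
    using L'(1) *(1) lpath_append[OF assms(2), of E a zs] zs by simp
  ultimately show False by blast
qed

lemma lpath_append_iff:
  assumes "odd (length M)"
  shows "lpath E (M @ ys) \<longleftrightarrow> lpath E M \<and> lpath E (last M # ys)"
proof -
  have M: "M = butlast M @ [last M]" using assms by (cases M) auto
  have "even (length (butlast M))" using assms by simp
  from lpath_append[OF this, of E "last M" ys] show ?thesis
    by (subst M, subst (3) M) simp
qed

lemma rigid_prefix:
  assumes "rigid E W (M @ ys)" "odd (length M)"
  shows "rigid E W M"
  unfolding rigid_def
proof (intro conjI allI impI notI)
  have *: "lpath E M" "lpath E (last M # ys)"
    using assms unfolding rigid_def by (auto simp: lpath_append_iff)
  show "lpath E M" by fact
  show "distinct M" "set M \<inter> W = {}"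
    using assms unfolding rigid_def by auto
  fix L' assume L': "lpath E L'" "distinct L'" "set L' \<subseteq> set M \<union> W" "hd L' = hd M"
    "last L' = last M" "length L' = length M + 2"
  have ne: "M \<noteq> []" "L' \<noteq> []" using assms L' by auto
  have "\<not> lpath E (L' @ ys)"
  proof (rule rigidD[OF assms(1)])
    show "distinct (L' @ ys)" using assms(1) L' unfolding rigid_def by auto
  qed (use L' ne in \<open>auto simp: hd_append last_append\<close>)
  moreover have "lpath E (L' @ ys)"
    using L' * assms(2) by (simp add: lpath_append_iff)
  ultimately show False by blast
qed

text \<open>
  A detour between the consecutive entries \<open>w, w'\<close> of \<open>ws\<close> consists of the edges
  \<open>{w, p, q}\<close> and \<open>{q, r, w'}\<close>; the list \<open>ss\<close> collects the triples \<open>p, q, r\<close>.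
\<close>

fun chain :: "('a set \<Rightarrow> bool) \<Rightarrow> 'a list \<Rightarrow> 'a list \<Rightarrow> bool" where
  "chain B [w] [] \<longleftrightarrow> True"
| "chain B (w # w' # ws) (p # q # r # ss) \<longleftrightarrow> B {w, p, q} \<and> B {q, r, w'} \<and> chain B (w' # ws) ss"
| "chain B _ _ \<longleftrightarrow> False"

fun avoids :: "'a list \<Rightarrow> 'a list \<Rightarrow> bool" where
  "avoids [] [w] \<longleftrightarrow> True"
| "avoids (x # xs) (w # w' # ws) \<longleftrightarrow> w \<noteq> x \<and> w' \<noteq> x \<and> w \<noteq> w' \<and> avoids xs (w' # ws)"
| "avoids _ _ \<longleftrightarrow> False"

text \<open>
  The forbidden endpoints \<open>xs\<close> (one for each detour) are fixed before \<open>ws\<close>, while the triples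
  may depend on all of \<open>ws\<close>: two neighbouring pairs of edges sometimes have to be treated jointly.
\<close>

definition linkable :: "('a set \<Rightarrow> bool) \<Rightarrow> 'a set \<Rightarrow> nat \<Rightarrow> 'a set \<Rightarrow> bool" where
  "linkable B W k A \<longleftrightarrow> (\<exists>xs. length xs = k \<and>
    (\<forall>ws. set ws \<subseteq> W \<longrightarrow> avoids xs ws \<longrightarrow>
       (\<exists>ss. distinct ss \<and> set ss \<subseteq> A \<and> chain B ws ss)))"

lemma linkable_0: "linkable B W 0 A"
  unfolding linkable_def
proof (rule exI[of _ "[]"], intro conjI allI impI)
  fix ws assume "set ws \<subseteq> W" "avoids [] ws"
  then obtain w where "ws = [w]" by (cases "([]::'a list, ws)" rule: avoids.cases) auto
  then show "\<exists>ss. distinct ss \<and> set ss \<subseteq> A \<and> chain B ws ss"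
    by (intro exI[of _ "[]"]) auto
qed simp

lemma linkable_mono:
  assumes "linkable B W k A" "A \<subseteq> A'"
  shows "linkable B W k A'"
proof -
  obtain xs where xs: "length xs = k"
    "\<And>ws. set ws \<subseteq> W \<Longrightarrow> avoids xs ws \<Longrightarrow> \<exists>ss. distinct ss \<and> set ss \<subseteq> A \<and> chain B ws ss"
    using assms(1) unfolding linkable_def by blast
  show ?thesis
    unfolding linkable_def
  proof (rule exI[of _ xs], intro conjI allI impI)
    fix ws assume "set ws \<subseteq> W" "avoids xs ws"
    then show "\<exists>ss. distinct ss \<and> set ss \<subseteq> A' \<and> chain B ws ss"
      using xs(2) assms(2) by (meson subset_trans)
  qed (use xs in simp)
qed

text \<open>The new detour has at most one exceptional endpoint \<open>v\<close>, which is put in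
  front of the forbidden endpoints.\<close>

lemma linkable_Suc:
  assumes A: "linkable B W k A"
    and step: "\<And>x y. x \<in> W \<Longrightarrow> y \<in> W \<Longrightarrow> x \<noteq> y \<Longrightarrow> x \<noteq> v \<Longrightarrow> y \<noteq> v \<Longrightarrow>
      \<exists>p q r. distinct [p, q, r] \<and> {p, q, r} \<subseteq> A' \<and> B {x, p, q} \<and> B {q, r, y}"
    and disj: "A' \<inter> A = {}"
  shows "linkable B W (Suc k) (A' \<union> A)"
proof -
  obtain xs where xs: "length xs = k"
    "\<And>ws. set ws \<subseteq> W \<Longrightarrow> avoids xs ws \<Longrightarrow> \<exists>ss. distinct ss \<and> set ss \<subseteq> A \<and> chain B ws ss"
    using A unfolding linkable_def by blast
  show ?thesis
    unfolding linkable_def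
  proof (rule exI[of _ "v # xs"], intro conjI allI impI)
    fix ws assume ws: "set ws \<subseteq> W" "avoids (v # xs) ws"
    then obtain x y ws' where w: "ws = x # y # ws'"
      by (cases "(v # xs, ws)" rule: avoids.cases) auto
    obtain ss where ss: "distinct ss" "set ss \<subseteq> A" "chain B (y # ws') ss"
      using xs(2)[of "y # ws'"] ws w by auto
    obtain p q r where pqr: "distinct [p, q, r]" "{p, q, r} \<subseteq> A'" "B {x, p, q}" "B {q, r, y}"
      using step[of x y] ws w by auto
    show "\<exists>ss. distinct ss \<and> set ss \<subseteq> A' \<union> A \<and> chain B ws ss"
      using ss pqr disj w by (intro exI[of _ "p # q # r # ss"]) auto
  qed (use xs in simp)
qed

text \<open>Serves two neighbouring pairs of edges whose detours must be chosen jointly. Here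
  \<open>x\<close> and \<open>z\<close> may coincide, since \<open>avoids\<close> separates only
  consecutive entries.\<close>

lemma linkable_Suc_Suc:
  assumes A: "linkable B W k A"
    and step: "\<And>x y z. {x, y, z} \<subseteq> W \<Longrightarrow> x \<noteq> y \<Longrightarrow> y \<noteq> z \<Longrightarrow>
      \<exists>p q r p' q' r'. distinct [p, q, r, p', q', r'] \<and> {p, q, r, p', q', r'} \<subseteq> A' \<and>
        B {x, p, q} \<and> B {q, r, y} \<and> B {y, p', q'} \<and> B {q', r', z}"
    and disj: "A' \<inter> A = {}"
  shows "linkable B W (Suc (Suc k)) (A' \<union> A)"
proof -
  obtain xs where xs: "length xs = k"
    "\<And>ws. set ws \<subseteq> W \<Longrightarrow> avoids xs ws \<Longrightarrow> \<exists>ss. distinct ss \<and> set ss \<subseteq> A \<and> chain B ws ss"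
    using A unfolding linkable_def by blast
  show ?thesis
    unfolding linkable_def
  \<comment> \<open>These two detours have no exceptional endpoint; arbitrary entries hold their
    places in the list.\<close>
  proof (rule exI[of _ "undefined # undefined # xs"], intro conjI allI impI)
    fix ws assume ws: "set ws \<subseteq> W" "avoids (undefined # undefined # xs) ws"
    then obtain x ws' where w: "ws = x # ws'" "avoids (undefined # xs) ws'"
      by (cases "(undefined # undefined # xs, ws)" rule: avoids.cases) auto
    then obtain y z ws'' where w': "ws = x # y # z # ws''"
      by (cases "(undefined # xs, ws')" rule: avoids.cases) auto
    obtain ss where ss: "distinct ss" "set ss \<subseteq> A" "chain B (z # ws'') ss"
      using xs(2)[of "z # ws''"] ws w' by auto
    obtain p q r p' q' r' where pqr: "distinct [p, q, r, p', q', r']" "{p, q, r, p', q', r'} \<subseteq> A'"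
        "B {x, p, q}" "B {q, r, y}" "B {y, p', q'}" "B {q', r', z}"
      using step[of x y z] ws w' by auto
    show "\<exists>ss. distinct ss \<and> set ss \<subseteq> A' \<union> A \<and> chain B ws ss"
      using ss pqr disj w' by (intro exI[of _ "p # q # r # p' # q' # r' # ss"]) auto
  qed (use xs in simp)
qed

section \<open>Blue triples forced by a rigid red path\<close>

lemma ex3I: "P p q r \<Longrightarrow> \<exists>p q r. P p q r"
  by blast

lemma ex6I: "P p q r p' q' r' \<Longrightarrow> \<exists>p q r p' q' r'. P p q r p' q' r'"
  by blast

text \<open>If \<open>{a, b, v}\<close> is red, then a red \<open>{b, x, d}\<close> followed by
  \<open>{d, c, e}\<close>, or a red \<open>{b, y, c}\<close> followed by \<open>{c, d, e}\<close>,
  would complete three red edges from \<open>a\<close> to \<open>e\<close>. The case of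
  \<open>{d, e, v}\<close> is the mirror image. The detour spares \<open>a\<close> and
  \<open>e\<close>, which stay free for the neighbouring pairs.\<close>

lemma rigid_neutral:
  assumes R: "rigid E W (a # b # c # d # e # ys)" and v: "v \<in> W" "E {a, b, v} \<or> E {d, e, v}"
    and w: "x \<in> W" "y \<in> W" "x \<noteq> v" "y \<noteq> v"
  shows "\<exists>p q r. distinct [p, q, r] \<and> {p, q, r} \<subseteq> {b, c, d} \<and> \<not> E {x, p, q} \<and> \<not> E {q, r, y}"
proof -
  have L: "E {a, b, c}" "E {c, d, e}" "lpath E (e # ys)" "distinct (a # b # c # d # e # ys)"
    "set (a # b # c # d # e # ys) \<inter> W = {}"
    using R unfolding rigid_def by auto
  note D = rigidD[OF R]
  show ?thesis
  proof (cases "E {a, b, v}")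
    case True
    have "\<not> E {x, d, b}" "\<not> E {b, c, y}"
      using D[of "a # v # b # x # d # c # e # ys"] D[of "a # v # b # y # c # d # e # ys"] L True v w
      by (auto simp: insert_commute)
    then show ?thesis
      using L by (intro ex3I[of _ d b c]) auto
  next
    case False
    have "\<not> E {x, b, d}" "\<not> E {d, c, y}"
      using D[of "a # c # b # x # d # v # e # ys"] D[of "a # b # c # y # d # v # e # ys"] L False v w
      by (auto simp: insert_commute)
    then show ?thesis
      using L by (intro ex3I[of _ b d c]) auto
  qed
qed

text \<open>The red edges \<open>{a, d, p}\<close> and \<open>{p, c, b}\<close> lead from
  \<open>a\<close> to \<open>b\<close>, or to \<open>c\<close> after exchanging \<open>b\<close> and
  \<open>c\<close>. From there a red edge through \<open>z\<close> to \<open>e\<close> would gain an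
  edge, and so would one to \<open>f\<close>, continued by the red \<open>{f, e, g}\<close>.\<close>

lemma rigid_pending:
  assumes R: "rigid E W (a # b # c # d # e # ys)"
    and p: "p \<in> W" "E {a, d, p}" "E {b, c, p}" and z: "z \<in> W" "z \<noteq> p"
  shows "\<not> E {b, e, z}" "\<not> E {c, e, z}"
    and "ys = f # g # h # zs \<Longrightarrow> \<not> E {b, f, z}" "ys = f # g # h # zs \<Longrightarrow> \<not> E {c, f, z}"
proof -
  have L: "E {a, b, c}" "E {c, d, e}" "lpath E (e # ys)" "distinct (a # b # c # d # e # ys)"
    "set (a # b # c # d # e # ys) \<inter> W = {}"
    using R unfolding rigid_def by auto
  note D = rigidD[OF R]
  show "\<not> E {b, e, z}"
    using D[of "a # d # p # c # b # z # e # ys"] L p z by (auto simp: insert_commute)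
  show "\<not> E {c, e, z}"
    using D[of "a # d # p # b # c # z # e # ys"] L p z by (auto simp: insert_commute)
  assume ys: "ys = f # g # h # zs"
  show "\<not> E {b, f, z}"
    using D[of "a # d # p # c # b # z # f # e # g # h # zs"] L p z ys by (auto simp: insert_commute)
  show "\<not> E {c, f, z}"
    using D[of "a # d # p # b # c # z # f # e # g # h # zs"] L p z ys by (auto simp: insert_commute)
qed

text \<open>
  Records a pair of edges \<open>abc, cde\<close> whose available detour \<open>c, e, d\<close> uses \<open>e = hd L\<close>, where
  \<open>L\<close> is the rest of the path. If the next pair of edges also needs \<open>e\<close>, the blue edges through
  \<open>L ! 1\<close> allow another choice for both.
\<close>

definition pending :: "('a set \<Rightarrow> bool) \<Rightarrow> 'a set \<Rightarrow> 'a \<Rightarrow> 'a \<Rightarrow> 'a \<Rightarrow> 'a list \<Rightarrow> bool" where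
  "pending E W b c d L \<longleftrightarrow> distinct [b, c, d] \<and> {b, c, d} \<inter> set L = {} \<and>
    (\<forall>z\<in>W. \<not> E {b, hd L, z} \<and> \<not> E {c, hd L, z} \<and> \<not> E {d, hd L, z}) \<and>
    (length L > 1 \<longrightarrow> (\<forall>z\<in>W. \<not> E {b, L ! 1, z} \<and> \<not> E {c, L ! 1, z}))"

text \<open>\<open>?F\<close> finds one more detour for the pair \<open>abc, cde\<close>;
  \<open>?G\<close> also serves a pending triple \<open>b', c', d'\<close>, whose own detour wants
  \<open>a\<close>. Either the current pair spares \<open>a\<close> and \<open>e\<close>, or it
  becomes pending and wants \<open>e\<close>, or it uses \<open>a\<close> and leaves
  \<open>e\<close> to the rest.\<close>

lemma rigid_linkable_step:
  assumes R: "rigid E W (a # b # c # d # e # ys)" and ys: "length ys = 4 * k"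
    and F1: "linkable (\<lambda>e. \<not> E e) W k (set (e # ys))"
    and G1: "\<And>b c d. pending E W b c d (e # ys) \<Longrightarrow>
      linkable (\<lambda>e. \<not> E e) W (Suc k) ({b, c, d} \<union> set (e # ys))"
  shows "linkable (\<lambda>e. \<not> E e) W (Suc k) (set (a # b # c # d # e # ys))" (is ?F)
    and "pending E W b' c' d' (a # b # c # d # e # ys) \<Longrightarrow>
      linkable (\<lambda>e. \<not> E e) W (Suc (Suc k)) ({b', c', d'} \<union> set (a # b # c # d # e # ys))"
    (is "_ \<Longrightarrow> ?G")
proof -
  let ?L = "a # b # c # d # e # ys"
  let ?P = "pending E W b' c' d' ?L"
  have dist: "distinct ?L" and W: "set ?L \<inter> W = {}"
    using R unfolding rigid_def by auto
  have pend: "distinct [b', c', d']" "{b', c', d'} \<inter> set ?L = {}"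
    and blue: "\<And>z. z \<in> W \<Longrightarrow> \<not> E {b', a, z} \<and> \<not> E {c', a, z} \<and> \<not> E {d', a, z} \<and> \<not> E {b', b, z} \<and> \<not> E {c', b, z}"
    if ?P
    using that unfolding pending_def by auto
  \<comment> \<open>If the current pair and the rest do without \<open>a\<close>, the pending triple
    takes the detour \<open>c', a, d'\<close>.\<close>
  have prefix: ?G if P: ?P and A: "linkable (\<lambda>e. \<not> E e) W (Suc k) (set (b # c # d # e # ys))"
  proof -
    have "linkable (\<lambda>e. \<not> E e) W (Suc (Suc k)) ({c', a, d'} \<union> set (b # c # d # e # ys))"
    proof (rule linkable_Suc[OF A])
      fix x y assume xy: "x \<in> W" "y \<in> W"
      have "\<not> E {x, c', a}" "\<not> E {a, d', y}"
        using blue[OF P xy(1)] blue[OF P xy(2)] by (auto simp: insert_commute)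
      then show "\<exists>p q r. distinct [p, q, r] \<and> {p, q, r} \<subseteq> {c', a, d'} \<and> \<not> E {x, p, q} \<and> \<not> E {q, r, y}"
        using pend[OF P] by (intro ex3I[of _ c' a d']) auto
    qed (use pend[OF P] dist in auto)
    then show ?thesis by (rule linkable_mono) auto
  qed
  consider (neutral) v where "v \<in> W" "E {a, b, v} \<or> E {d, e, v}"
    | (pending) p p' where "\<And>z. z \<in> W \<Longrightarrow> \<not> E {a, b, z} \<and> \<not> E {d, e, z}"
        "p \<in> W" "p' \<in> W" "p \<noteq> p'" "E {a, d, p}" "E {b, c, p}" "E {a, d, p'}" "E {b, c, p'}"
    | (left) "\<And>z. z \<in> W \<Longrightarrow> \<not> E {a, b, z} \<and> \<not> E {d, e, z}"
        "\<And>x y. x \<in> W \<Longrightarrow> y \<in> W \<Longrightarrow> x \<noteq> y \<Longrightarrow> \<not> E {a, d, x} \<or> \<not> E {b, c, x} \<or> \<not> E {a, d, y} \<or> \<not> E {b, c, y}"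
    by blast
  then have "?F \<and> (?P \<longrightarrow> ?G)"
  proof cases
    case neutral
    have A: "linkable (\<lambda>e. \<not> E e) W (Suc k) ({b, c, d} \<union> set (e # ys))"
      by (rule linkable_Suc[OF F1, where v = v])
        (use rigid_neutral[OF R neutral] dist in auto)
    have A': "linkable (\<lambda>e. \<not> E e) W (Suc k) (set (b # c # d # e # ys))"
      by (rule linkable_mono[OF A]) auto
    moreover have ?F
      by (rule linkable_mono[OF A]) auto
    ultimately show ?thesis using prefix by blast
  next
    case pending
    \<comment> \<open>Two vertices \<open>p\<close>, \<open>p'\<close> are at hand so that every
      \<open>z\<close> differs from one of them.\<close>
    have p: "\<exists>q\<in>W. E {a, d, q} \<and> E {b, c, q} \<and> z \<noteq> q" for z
      using pending(2-) by blast
    have be: "\<not> E {b, e, z} \<and> \<not> E {c, e, z}" if "z \<in> W" for z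
      using p[of z] rigid_pending(1,2)[OF R] that by blast
    have bf: "\<not> E {b, ys ! 0, z} \<and> \<not> E {c, ys ! 0, z}" if "z \<in> W" "ys \<noteq> []" for z
    proof -
      obtain f g h zs where "ys = f # g # h # zs"
        using ys \<open>ys \<noteq> []\<close> by (cases k) (auto simp: length_Suc_conv numeral_eq_Suc)
      then show ?thesis using p[of z] rigid_pending(3,4)[OF R] that by (metis nth_Cons_0)
    qed
    have "pending E W b c d (e # ys)"
      unfolding pending_def using be bf dist pending(1) by auto
    then have A: "linkable (\<lambda>e. \<not> E e) W (Suc k) ({b, c, d} \<union> set (e # ys))"
      by (rule G1)
    have A': "linkable (\<lambda>e. \<not> E e) W (Suc k) (set (b # c # d # e # ys))"
      by (rule linkable_mono[OF A]) auto
    moreover have ?F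
      by (rule linkable_mono[OF A]) auto
    ultimately show ?thesis using prefix by blast
  next
    case left
    have "linkable (\<lambda>e. \<not> E e) W (Suc k) ({a, b, c, d} \<union> set (e # ys))"
    proof (rule linkable_Suc[OF F1])
      fix x y assume xy: "x \<in> W" "y \<in> W" "x \<noteq> y"
      have ab: "\<not> E {x, b, a}" "\<not> E {x, a, b}" "\<not> E {a, b, y}" "\<not> E {b, a, y}"
        using left(1)[OF xy(1)] left(1)[OF xy(2)] by (auto simp: insert_commute)
      \<comment> \<open>Since \<open>{a, b, x}\<close> and \<open>{a, b, y}\<close> are blue, a
        single further blue triple completes a detour, and \<open>e\<close> stays free.\<close>
      consider "\<not> E {x, d, a}" | "\<not> E {x, c, b}" | "\<not> E {a, d, y}" | "\<not> E {b, c, y}"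
        using left(2)[OF xy] by (auto simp: insert_commute)
      then show "\<exists>p q r. distinct [p, q, r] \<and> {p, q, r} \<subseteq> {a, b, c, d} \<and> \<not> E {x, p, q} \<and> \<not> E {q, r, y}"
      proof cases
        case 1
        then show ?thesis
          using ab dist by (intro ex3I[of _ d a b]) auto
      next
        case 2
        then show ?thesis
          using ab dist by (intro ex3I[of _ c b a]) auto
      next
        case 3
        then show ?thesis
          using ab dist by (intro ex3I[of _ b a d]) auto
      next
        case 4
        then show ?thesis
          using ab dist by (intro ex3I[of _ a b c]) auto
      qed
    qed (use dist in auto)
    then have ?F by (rule linkable_mono) auto
    moreover have ?G if P: ?P
    proof -
      have "linkable (\<lambda>e. \<not> E e) W (Suc (Suc k)) ({a, b, c, d, b', c', d'} \<union> set (e # ys))"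
      proof (rule linkable_Suc_Suc[OF F1])
        fix x y z assume "{x, y, z} \<subseteq> W" and xyz: "x \<noteq> y" "y \<noteq> z"
        then have w: "x \<in> W" "y \<in> W" "z \<in> W" by auto
        have blues: "\<not> E {x, c', a}" "\<not> E {a, d', y}" "\<not> E {x, b', b}" "\<not> E {b, c', y}"
          "\<not> E {y, b', b}" "\<not> E {b, b', z}" "\<not> E {y, d', a}" "\<not> E {a, d', z}"
          using blue[OF P w(1)] blue[OF P w(2)] blue[OF P w(3)] by (auto simp: insert_commute)
        have D: "distinct [a, b, c, d, b', c', d']" "distinct [d', c', b', d, c, b, a]"
          using pend[OF P] dist by auto
        \<comment> \<open>One detour gets the middle vertex \<open>a\<close>, the other
          \<open>b\<close>. The blue triple found here decides which of them joins \<open>y\<close>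
          to \<open>z\<close>; the other three triples are blue because of the pending
          triple.\<close>
        consider "\<not> E {y, d, a}" | "\<not> E {y, c, b}" | "\<not> E {a, d, z}" | "\<not> E {b, c, z}"
          using left(2)[OF w(2,3) xyz(2)] by (auto simp: insert_commute)
        then show "\<exists>p q r p' q' r'. distinct [p, q, r, p', q', r'] \<and>
            {p, q, r, p', q', r'} \<subseteq> {a, b, c, d, b', c', d'} \<and>
            \<not> E {x, p, q} \<and> \<not> E {q, r, y} \<and> \<not> E {y, p', q'} \<and> \<not> E {q', r', z}"
        proof cases
          case 1
          then show ?thesis
            using blues D
            by (intro ex6I[of _ b' b c' d a d']) simp
        next
          case 2
          then show ?thesis
            using blues D
            by (intro ex6I[of _ c' a d' c b b']) simp
        next
          case 3
          then show ?thesis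
            using blues D
            by (intro ex6I[of _ b' b c' d' a d]) simp
        next
          case 4
          then show ?thesis
            using blues D
            by (intro ex6I[of _ c' a d' b' b c]) simp
        qed
      qed (use dist pend[OF P] in auto)
      then show ?thesis by (rule linkable_mono) auto
    qed
    ultimately show ?thesis by blast
  qed
  then show ?F "?P \<Longrightarrow> ?G" by blast+
qed

text \<open>Each induction step removes \<open>a, b, c, d\<close> and keeps the shared vertex
  \<open>e\<close>. The second conjunct allows a pair to hand its claim on \<open>e\<close> to the
  induction hypothesis.\<close>

lemma rigid_linkable_aux:
  assumes "rigid E W L" "length L = 4 * k + 1"
  shows "linkable (\<lambda>e. \<not> E e) W k (set L) \<and> (\<forall>b c d. pending E W b c d L \<longrightarrow>
      linkable (\<lambda>e. \<not> E e) W (Suc k) ({b, c, d} \<union> set L))"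
  using assms
proof (induction k arbitrary: L)
  case 0
  then obtain a where L: "L = [a]" by (auto simp: length_Suc_conv)
  have "linkable (\<lambda>e. \<not> E e) W (Suc 0) ({b, c, d} \<union> set L)" if P: "pending E W b c d L" for b c d
  proof -
    \<comment> \<open>No edge is left, so the last vertex \<open>a\<close> is free for the pending
      detour.\<close>
    have "linkable (\<lambda>e. \<not> E e) W (Suc 0) ({c, a, d} \<union> {})"
    proof (rule linkable_Suc[OF linkable_0])
      fix x y assume xy: "x \<in> W" "y \<in> W"
      have "\<not> E {x, c, a}" "\<not> E {a, d, y}"
        using P xy unfolding pending_def L by (auto simp: insert_commute)
      then show "\<exists>p q r. distinct [p, q, r] \<and> {p, q, r} \<subseteq> {c, a, d} \<and> \<not> E {x, p, q} \<and> \<not> E {q, r, y}"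
        using P unfolding pending_def L by (intro ex3I[of _ c a d]) auto
    qed auto
    then show ?thesis by (rule linkable_mono) (auto simp: L)
  qed
  then show ?case using linkable_0 by blast
next
  case (Suc k)
  then obtain a b c d e ys where L: "L = a # b # c # d # e # ys" and ys: "length ys = 4 * k"
    by (auto simp: length_Suc_conv numeral_eq_Suc)
  have R: "rigid E W (a # b # c # d # e # ys)" using Suc.prems L by simp
  have IH: "linkable (\<lambda>e. \<not> E e) W k (set (e # ys)) \<and> (\<forall>b c d. pending E W b c d (e # ys) \<longrightarrow>
      linkable (\<lambda>e. \<not> E e) W (Suc k) ({b, c, d} \<union> set (e # ys)))"
    by (rule Suc.IH) (use rigid_append[of E W "[a, b, c, d]" "e # ys"] R ys in auto)
  show ?case
    unfolding L using rigid_linkable_step[OF R ys] IH by blast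
qed

lemma rigid_linkable:
  "rigid E W L \<Longrightarrow> length L = 4 * k + 1 \<Longrightarrow> linkable (\<lambda>e. \<not> E e) W k (set L)"
  using rigid_linkable_aux by blast

text \<open>Greedy choice: a new vertex has to avoid the forbidden entry of the detour it ends and
  of the one it starts. The last vertex only ends a detour, so two candidates suffice there.
  \<open>take 1 xs\<close> holds the first forbidden entry, if any.\<close>

lemma ex_avoids:
  assumes "finite U" "length xs < card U" "w \<notin> U" "w \<notin> set (take 1 xs)"
  shows "\<exists>ws. avoids xs (w # ws) \<and> distinct (w # ws) \<and> set ws \<subseteq> U"
  using assms
proof (induction xs arbitrary: U w)
  case Nil
  then show ?case by (intro exI[of _ "[]"]) auto
next
  case (Cons x xs)
  have "card (insert x (set (take 1 xs))) < card U"
  proof (cases xs)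
    case Nil
    then show ?thesis using Cons.prems by simp
  next
    case (Cons y ys)
    have "card {x, y} \<le> 2" by (simp add: card_insert_if)
    then show ?thesis using Cons.prems Cons by simp
  qed
  then have "\<not> U \<subseteq> insert x (set (take 1 xs))"
    by (metis List.finite_set card_mono finite_insert not_less)
  then obtain w' where w': "w' \<in> U" "w' \<noteq> x" "w' \<notin> set (take 1 xs)" by blast
  have "\<exists>ws. avoids xs (w' # ws) \<and> distinct (w' # ws) \<and> set ws \<subseteq> U - {w'}"
    using Cons.prems w' by (intro Cons.IH) auto
  then obtain ws where "avoids xs (w' # ws)" "distinct (w' # ws)" "set ws \<subseteq> U - {w'}" by blast
  then show ?case
    using Cons.prems w' by (intro exI[of _ "w' # ws"]) auto
qed

lemma length_avoids: "avoids xs ws \<Longrightarrow> length ws = Suc (length xs)"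
  by (induction xs ws rule: avoids.induct) auto

section \<open>From detours to long paths and cycles of the other colour\<close>

fun weave :: "'a list \<Rightarrow> 'a list \<Rightarrow> 'a list" where
  "weave (w # ws) (p # q # r # ss) = w # p # q # r # weave ws ss"
| "weave ws ss = ws"

lemma chain_weave:
  assumes "chain B ws ss"
  shows "lpath B (weave ws ss)" "set (weave ws ss) = set ws \<union> set ss"
    "hd (weave ws ss) = hd ws" "last (weave ws ss) = last ws"
    "length (weave ws ss) + 3 = 4 * length ws" "weave ws ss \<noteq> []"
    "distinct ws \<Longrightarrow> distinct ss \<Longrightarrow> set ws \<inter> set ss = {} \<Longrightarrow> distinct (weave ws ss)"
proof -
  have "lpath B (weave ws ss) \<and> set (weave ws ss) = set ws \<union> set ss \<and> hd (weave ws ss) = hd ws \<and>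
    last (weave ws ss) = last ws \<and> length (weave ws ss) + 3 = 4 * length ws \<and> weave ws ss \<noteq> [] \<and>
    (distinct ws \<longrightarrow> distinct ss \<longrightarrow> set ws \<inter> set ss = {} \<longrightarrow> distinct (weave ws ss))"
    using assms
  proof (induction B ws ss rule: chain.induct)
    case (2 B w w' ws p q r ss)
    then have IH: "lpath B (weave (w' # ws) ss)" "set (weave (w' # ws) ss) = set (w' # ws) \<union> set ss"
      "hd (weave (w' # ws) ss) = w'" "last (weave (w' # ws) ss) = last (w' # ws)"
      "length (weave (w' # ws) ss) + 3 = 4 * length (w' # ws)" "weave (w' # ws) ss \<noteq> []"
      "distinct (w' # ws) \<longrightarrow> distinct ss \<longrightarrow> set (w' # ws) \<inter> set ss = {} \<longrightarrow> distinct (weave (w' # ws) ss)"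
      by auto
    obtain zs where zs: "weave (w' # ws) ss = w' # zs"
      using IH(3,6) by (cases "weave (w' # ws) ss") auto
    have set: "set (weave (w # w' # ws) (p # q # r # ss)) = set (w # w' # ws) \<union> set (p # q # r # ss)"
      using IH(2) by auto
    moreover have "distinct (weave (w # w' # ws) (p # q # r # ss))"
      if "distinct (w # w' # ws)" "distinct (p # q # r # ss)" "set (w # w' # ws) \<inter> set (p # q # r # ss) = {}"
      using that IH(2,7) by auto
    moreover have "lpath B (weave (w # w' # ws) (p # q # r # ss))"
      using 2(2) IH(1) by (simp add: zs)
    ultimately show ?case using IH(4,5,6) by simp
  qed auto
  then show "lpath B (weave ws ss)" "set (weave ws ss) = set ws \<union> set ss"
    "hd (weave ws ss) = hd ws" "last (weave ws ss) = last ws"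
    "length (weave ws ss) + 3 = 4 * length ws" "weave ws ss \<noteq> []"
    "distinct ws \<Longrightarrow> distinct ss \<Longrightarrow> set ws \<inter> set ss = {} \<Longrightarrow> distinct (weave ws ss)"
    by auto
qed

text \<open>The detours join \<open>k + 1\<close> vertices of \<open>W\<close>; one spare vertex
  leaves room to avoid the forbidden endpoints.\<close>

lemma linkable_lpath:
  assumes link: "linkable B W k A" and W: "finite W" "k + 2 \<le> card W" and disj: "W \<inter> A = {}"
  obtains Q where "lpath B Q" "distinct Q" "length Q = 4 * k + 1" "set Q \<subseteq> W \<union> A"
    "hd Q \<in> W" "last Q \<in> W" "card (set Q \<inter> W) = k + 1"
proof -
  obtain xs where xs: "length xs = k"
    "\<And>ws. set ws \<subseteq> W \<Longrightarrow> avoids xs ws \<Longrightarrow> \<exists>ss. distinct ss \<and> set ss \<subseteq> A \<and> chain B ws ss"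
    using link unfolding linkable_def by blast
  have "card (set (take 1 xs)) \<le> 1"
    by (metis card_length le_trans length_take min.cobounded2)
  then have "\<not> W \<subseteq> set (take 1 xs)"
    using W by (metis List.finite_set add_leE card_mono le_trans not_less_eq_eq one_add_one plus_1_eq_Suc)
  then obtain w where w: "w \<in> W" "w \<notin> set (take 1 xs)" by blast
  have "\<exists>ws. avoids xs (w # ws) \<and> distinct (w # ws) \<and> set ws \<subseteq> W - {w}"
    using w W xs(1) by (intro ex_avoids) auto
  then obtain ws where ws: "avoids xs (w # ws)" "distinct (w # ws)" "set (w # ws) \<subseteq> W"
    using w by auto
  obtain ss where ss: "distinct ss" "set ss \<subseteq> A" "chain B (w # ws) ss"
    using xs(2) ws by blast
  note Q = chain_weave[OF ss(3)]
  have len: "length (w # ws) = k + 1" using length_avoids[OF ws(1)] xs(1) by simp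
  have "set (weave (w # ws) ss) \<inter> W = set (w # ws)"
    using Q(2) ws(3) ss(2) disj by auto
  then have card: "card (set (weave (w # ws) ss) \<inter> W) = k + 1"
    using distinct_card[OF ws(2)] len by simp
  have dist: "distinct (weave (w # ws) ss)"
    using Q(7) ws ss disj by blast
  have "last (w # ws) \<in> W" using ws(3) last_in_set[of "w # ws"] by blast
  show ?thesis
  proof (intro that[of "weave (w # ws) ss"])
    show "length (weave (w # ws) ss) = 4 * k + 1" using Q(5) len by simp
    show "set (weave (w # ws) ss) \<subseteq> W \<union> A" using Q(2) ws(3) ss(2) by blast
    show "hd (weave (w # ws) ss) \<in> W" using Q(3) ws(3) by simp
    show "last (weave (w # ws) ss) \<in> W" using Q(4) \<open>last (w # ws) \<in> W\<close> by simp
  qed (fact Q(1) dist card)+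
qed

lemma lpath_snoc2:
  assumes "lpath E Q" "E {last Q, u, w}"
  shows "lpath E (Q @ [u, w])"
proof -
  have Q: "Q \<noteq> []" using assms(1) by auto
  then have *: "Q = butlast Q @ [last Q]" by simp
  have "even (length (butlast Q))"
    using lpath_odd[OF assms(1)] by simp
  then have "lpath E (butlast Q @ last Q # [u, w])"
    using assms * by (subst lpath_append) auto
  then show ?thesis using Q by (metis append_Cons append_Nil append.assoc append_butlast_last_id)
qed

text \<open>The ends of \<open>Q\<close> are joined by a zigzag through \<open>s + 1\<close>
  vertices of \<open>U\<close> and \<open>s\<close> new vertices of \<open>W\<close>. For
  \<open>s = 0\<close> the single edge \<open>{last Q, u, hd Q}\<close> must do, hence the condition
  on the ends.\<close>

lemma lcycle_close:
  assumes "lpath B Q" "distinct Q" "hd Q \<in> W" "last Q \<in> W"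
    and "s \<le> card (W - set Q)" "s < card (U - set Q)" "s = 0 \<longrightarrow> hd Q \<noteq> last Q"
    and fin: "finite W" "finite U" and disj: "W \<inter> U = {}"
    and B: "\<And>u w w'. u \<in> U \<Longrightarrow> w \<in> W \<Longrightarrow> w' \<in> W \<Longrightarrow> w \<noteq> w' \<Longrightarrow> B {w, u, w'}"
  shows "\<exists>ys. lcycle B ys \<and> distinct ys \<and> set ys \<subseteq> set Q \<union> W \<union> U \<and> length ys = length Q + 2 * s + 1"
  using assms(1-7)
proof (induction s arbitrary: Q)
  case 0
  have Q: "Q \<noteq> []" using 0(1) by auto
  have "U - set Q \<noteq> {}" using 0(6) by force
  then obtain u where u: "u \<in> U" "u \<notin> set Q" by blast
  have "B {last Q, u, hd Q}" using 0(3,4,7) u B by metis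
  then have "lpath B (Q @ [u, hd Q])" using 0(1) by (intro lpath_snoc2) auto
  then show ?case
    using u Q 0(2) by (intro exI[of _ "Q @ [u]"]) (auto simp: lcycle_def)
next
  case (Suc s)
  have Q: "Q \<noteq> []" using Suc.prems(1) by auto
  have "U - set Q \<noteq> {}" "W - set Q \<noteq> {}" using Suc.prems(5,6) by force+
  then obtain u w where u: "u \<in> U" "u \<notin> set Q" and w: "w \<in> W" "w \<notin> set Q" by blast
  let ?Q = "Q @ [u, w]"
  have lastQ: "last Q \<noteq> w" "hd Q \<noteq> w" using w Q by (metis last_in_set, metis hd_in_set)
  then have "B {last Q, u, w}" using Suc.prems(4) u w B by metis
  then have 1: "lpath B ?Q" using Suc.prems(1) by (intro lpath_snoc2) auto
  have uw: "u \<noteq> w" using u w disj by auto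
  have "W - set ?Q = (W - set Q) - {w}" "U - set ?Q = (U - set Q) - {u}"
    using disj u w by auto
  then have 2: "s \<le> card (W - set ?Q)" "s < card (U - set ?Q)"
    using Suc.prems(5,6) fin u w by auto
  have "distinct ?Q" "hd ?Q \<in> W" "last ?Q \<in> W" "s = 0 \<longrightarrow> hd ?Q \<noteq> last ?Q"
    using Suc.prems(2,3) u w uw lastQ Q by auto
  then obtain ys where ys: "lcycle B ys" "distinct ys" "set ys \<subseteq> set ?Q \<union> W \<union> U" "length ys = length ?Q + 2 * s + 1"
    using Suc.IH[of ?Q] 1 2 by blast
  have "set ys \<subseteq> set Q \<union> W \<union> U" using ys(3) u w by auto
  then show ?case using ys by (intro exI[of _ ys]) simp
qed

section \<open>Detours around a cycle that cannot be lengthened\<close>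

lemma rigid_lcycle:
  assumes "lcycle E (M @ R)" "distinct (M @ R)" "set (M @ R) \<inter> W = {}" "odd (length M)" "R \<noteq> []"
    and max: "\<And>ys. lcycle E ys \<Longrightarrow> distinct ys \<Longrightarrow> set ys \<subseteq> set (M @ R) \<union> W \<Longrightarrow> length ys \<noteq> length (M @ R) + 2"
  shows "rigid E W M"
  unfolding rigid_def
proof (intro conjI allI impI notI)
  have ne: "M \<noteq> []" using assms by auto
  have "lpath E (M @ R @ [hd M])" using assms(1) ne by (simp add: lcycle_def)
  then have *: "lpath E M" "lpath E (last M # R @ [hd M])"
    using assms(4) by (auto simp: lpath_append_iff)
  show "lpath E M" by fact
  show "distinct M" "set M \<inter> W = {}"
    using assms by auto
  fix L' assume L': "lpath E L'" "distinct L'" "set L' \<subseteq> set M \<union> W" "hd L' = hd M"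
    "last L' = last M" "length L' = length M + 2"
  have ne': "L' \<noteq> []" using L' by auto
  \<comment> \<open>Replacing the arc \<open>M\<close> by \<open>L'\<close> and keeping
    \<open>R\<close> would give a cycle with one more edge.\<close>
  have "lpath E (L' @ R @ [hd M])"
    using L' * assms(4) by (simp add: lpath_append_iff)
  then have "lcycle E (L' @ R)" using ne' L' by (simp add: lcycle_def)
  moreover have "distinct (L' @ R)" using assms L' by auto
  ultimately show False using max[of "L' @ R"] L' by auto
qed


lemma lcycle_rotate2:
  assumes "lcycle E ys" "2 < length ys"
  shows "lcycle E (rotate 2 ys)"
proof -
  obtain a b c zs where ys: "ys = a # b # c # zs"
    using assms(2) by (auto simp: less_eq_Suc_le length_Suc_conv numeral_eq_Suc Suc_le_length_iff)
  have *: "lpath E ((c # zs) @ [a])" "E {a, b, c}"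
    using assms(1) by (auto simp: lcycle_def ys)
  then have "even (length (c # zs))" using lpath_odd by fastforce
  from lpath_append[OF this, of E a "[b, c]"]
  have "lpath E ((c # zs) @ [a, b, c])" using * by simp
  then show ?thesis by (simp add: ys lcycle_def numeral_2_eq_2)
qed

lemma lcycle_rotate:
  assumes "lcycle E ys" "2 < length ys"
  shows "lcycle E (rotate (2 * n) ys)"
proof (induction n)
  case (Suc n)
  have "lcycle E (rotate 2 (rotate (2 * n) ys))"
    using Suc assms(2) by (intro lcycle_rotate2) auto
  then show ?case by (simp add: rotate_rotate)
qed (use assms in simp)

text \<open>Disjoint blocks of three consecutive vertices serve as detours.\<close>

lemma linkable_consecutive:
  assumes "distinct L" "3 * k \<le> length L"
    and "\<And>i z. Suc i < length L \<Longrightarrow> z \<in> W \<Longrightarrow> B {L ! i, L ! Suc i, z}"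
  shows "linkable B W k (set L)"
  using assms
proof (induction k arbitrary: L)
  case 0
  show ?case by (rule linkable_0)
next
  case (Suc k)
  then obtain p q r L' where L: "L = p # q # r # L'"
    by (auto simp: numeral_eq_Suc Suc_le_length_iff)
  have link: "linkable B W k (set L')"
    using Suc.prems(1,2) Suc.prems(3)[of "Suc (Suc (Suc i))" for i] by (intro Suc.IH) (auto simp: L)
  have "linkable B W (Suc k) ({p, q, r} \<union> set L')"
  proof (rule linkable_Suc[OF link])
    fix x y assume "x \<in> W" "y \<in> W"
    then have "B {x, p, q}" "B {q, r, y}"
      using Suc.prems(3)[of 0 x] Suc.prems(3)[of 1 y] by (auto simp: L insert_commute)
    then show "\<exists>p' q' r'. distinct [p', q', r'] \<and> {p', q', r'} \<subseteq> {p, q, r} \<and> B {x, p', q'} \<and> B {q', r', y}"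
      using Suc.prems(1) by (intro ex3I[of _ p q r]) (auto simp: L)
  qed (use Suc.prems(1) in \<open>auto simp: L\<close>)
  then show ?case by (rule linkable_mono) (auto simp: L)
qed

text \<open>For odd \<open>M = 2 * k + 1\<close> an arc of \<open>4 * k + 1\<close> vertices is
  rigid and provides all detours. For \<open>M = 2 * k\<close> the cycle has one vertex too few for
  such an arc, and a separate argument is needed.\<close>

lemma lcycle_linkable:
  fixes ys :: "'a list"
  assumes cyc: "lcycle E ys" "distinct ys" "length ys = 2 * M" "3 \<le> M" and disj: "set ys \<inter> W = {}"
    and max: "\<And>zs. lcycle E zs \<Longrightarrow> distinct zs \<Longrightarrow> set zs \<subseteq> set ys \<union> W \<Longrightarrow> length zs \<noteq> length ys + 2"
  shows "linkable (\<lambda>e. \<not> E e) W (M div 2) (set ys)"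
proof -
  define k where "k = M div 2"
  have rigid: "rigid E W M'"
    if "rotate (2 * n) ys = M' @ R" "odd (length M')" "R \<noteq> []" for n M' R
  proof (rule rigid_lcycle)
    have "set (M' @ R) = set ys" "length (M' @ R) = length ys"
      unfolding that(1)[symmetric] by simp_all
    then show "set (M' @ R) \<inter> W = {}"
      "\<And>zs. lcycle E zs \<Longrightarrow> distinct zs \<Longrightarrow> set zs \<subseteq> set (M' @ R) \<union> W \<Longrightarrow> length zs \<noteq> length (M' @ R) + 2"
      using disj max by auto
    show "lcycle E (M' @ R)"
      unfolding that(1)[symmetric] using cyc by (intro lcycle_rotate) auto
    show "distinct (M' @ R)"
      unfolding that(1)[symmetric] using cyc by simp
  qed (use that in auto)
  show ?thesis
  proof (cases "odd M")
    case True
    have "rigid E W (take (4 * k + 1) ys)"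
      using True cyc by (intro rigid[of 0 _ "drop (4 * k + 1) ys"]) (auto simp: k_def elim!: oddE)
    then have "linkable (\<lambda>e. \<not> E e) W k (set (take (4 * k + 1) ys))"
      using cyc(3) True by (intro rigid_linkable) (auto simp: k_def elim!: oddE)
    then show ?thesis
      unfolding k_def[symmetric] by (rule linkable_mono) (rule set_take_subset)
  next
    case False
    then have M: "M = 2 * k" and k: "2 \<le> k" using cyc(4) by (auto simp: k_def)
    \<comment> \<open>If some pair of edges satisfies the premise of \<open>rigid_neutral\<close>,
      its detour uses only \<open>b, c, d\<close>, and the arc from \<open>e\<close> round to
      \<open>a\<close> supplies \<open>k - 1\<close> more. Otherwise two consecutive vertices always
      form a blue triple with a vertex of \<open>W\<close>.\<close>
    show ?thesis
    proof (cases "\<exists>n a b c d e zs z. rotate (2 * n) ys = a # b # c # d # e # zs \<and> z \<in> W \<and> (E {a, b, z} \<or> E {d, e, z})")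
      case True
      then obtain n a b c d e zs z where rot: "rotate (2 * n) ys = a # b # c # d # e # zs"
        and z: "z \<in> W" "E {a, b, z} \<or> E {d, e, z}" by blast
      have set: "set (a # b # c # d # e # zs) = set ys" and "length (a # b # c # d # e # zs) = length ys"
        and dist: "distinct (a # b # c # d # e # zs)"
        unfolding rot[symmetric] using cyc by simp_all
      then have len: "length zs + 5 = 4 * k" using M cyc(3) by simp
      then have odd: "odd (length zs)" by presburger
      then have "zs \<noteq> []" by auto
      have R1: "rigid E W (a # b # c # d # e # [])"
        using rot \<open>zs \<noteq> []\<close> by (intro rigid[of n _ zs]) auto
      have "2 * (n + 2) = 4 + 2 * n" by simp
      then have "rotate (2 * (n + 2)) ys = rotate 4 (rotate (2 * n) ys)"
        by (simp only: rotate_rotate)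
      also have "\<dots> = rotate 4 (a # b # c # d # e # zs)"
        by (simp only: rot)
      also have "\<dots> = (e # zs @ [a]) @ [b, c, d]"
        by (simp add: numeral_eq_Suc)
      finally have "rigid E W (e # zs @ [a])"
        using odd by (intro rigid[of "n + 2" _ "[b, c, d]"]) auto
      then have link: "linkable (\<lambda>e. \<not> E e) W (k - 1) (set (e # zs @ [a]))"
        using len k by (intro rigid_linkable) auto
      have "linkable (\<lambda>e. \<not> E e) W (Suc (k - 1)) ({b, c, d} \<union> set (e # zs @ [a]))"
        by (rule linkable_Suc[OF link, where v = z])
          (use rigid_neutral[OF R1 z] dist in auto)
      then show ?thesis
        unfolding k_def[symmetric] set[symmetric] using k by simp (erule linkable_mono, auto)
    next
      case False
      have pair: "\<not> E {a, b, z} \<and> \<not> E {d, e, z}" if "rotate (2 * n) ys = a # b # c # d # e # zs" "z \<in> W"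
        for n a b c d e zs z
        using False that by blast
      \<comment> \<open>In a suitable rotation the two vertices become \<open>a, b\<close> for even
        \<open>i\<close> and \<open>d, e\<close> for odd \<open>i\<close>.\<close>
      have "\<not> E {ys ! i, ys ! Suc i, z}" if i: "Suc i < length ys" and z: "z \<in> W" for i z
      proof -
        have rot: "\<exists>a b c d e zs. rotate (2 * n) ys = a # b # c # d # e # zs" for n
        proof -
          have "\<exists>a b c d e zs. xs = a # b # c # d # e # zs" if "5 \<le> length xs" for xs :: "'a list"
            using that by (auto simp: numeral_eq_Suc Suc_le_length_iff)
          moreover have "5 \<le> length (rotate (2 * n) ys)" using cyc by simp
          ultimately show ?thesis by blast
        qed
        show ?thesis
        proof (cases "even i")
          case True
          then obtain n where n: "i = 2 * n" by blast
          obtain a b c d e zs where R: "rotate (2 * n) ys = a # b # c # d # e # zs"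
            using rot[of n] by blast
          have "a = ys ! i" "b = ys ! Suc i"
            using nth_rotate[of 0 ys "2 * n"] nth_rotate[of 1 ys "2 * n"] i cyc(3,4) by (auto simp: R n)
          then show ?thesis using pair[OF R z] by simp
        next
          case False
          then obtain j where j: "i = 2 * j + 1" by (rule oddE)
          \<comment> \<open>Rotating back by two entries brings position \<open>i\<close> to index
            3; a full turn is added to keep the number natural.\<close>
          define n where "n = j + M - 1"
          have n: "2 * n + 3 = i + length ys" "2 * n + 4 = Suc i + length ys"
            using j cyc(3,4) by (auto simp: n_def)
          obtain a b c d e zs where R: "rotate (2 * n) ys = a # b # c # d # e # zs"
            using rot[of n] by blast
          have "rotate (2 * n) ys ! 3 = ys ! ((2 * n + 3) mod length ys)"
            "rotate (2 * n) ys ! 4 = ys ! ((2 * n + 4) mod length ys)"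
            by (rule nth_rotate, use cyc in simp)+
          then have "d = ys ! i" "e = ys ! Suc i"
            using i mod_add_self2[of "Suc i" "length ys"] unfolding n R by simp_all
          then show ?thesis using pair[OF R z] by simp
        qed
      qed
      then show ?thesis
        unfolding k_def[symmetric] using cyc M by (intro linkable_consecutive) auto
    qed
  qed
qed

section \<open>Longest paths and cycles in a coloured vertex set\<close>

definition has_path :: "('a set \<Rightarrow> bool) \<Rightarrow> 'a set \<Rightarrow> nat \<Rightarrow> bool" where
  "has_path E V n \<longleftrightarrow> (\<exists>xs. lpath E xs \<and> distinct xs \<and> set xs \<subseteq> V \<and> length xs = 2 * n + 1)"

definition has_cycle :: "('a set \<Rightarrow> bool) \<Rightarrow> 'a set \<Rightarrow> nat \<Rightarrow> bool" where
  "has_cycle E V m \<longleftrightarrow> (\<exists>ys. lcycle E ys \<and> distinct ys \<and> set ys \<subseteq> V \<and> length ys = 2 * m)"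

text \<open>A red \<open>{w, u, w'}\<close> could be put in front of the path; \<open>a\<close> and
  \<open>b\<close> may be exchanged, as both lie only on the first edge.\<close>

lemma longest_path_end:
  assumes "lpath E (a # b # zs)" "distinct (a # b # zs)" "set (a # b # zs) \<subseteq> V"
    "length (a # b # zs) = 2 * n + 1" "\<not> has_path E V (Suc n)"
    and "u \<in> {a, b}" "w \<in> V - set (a # b # zs)" "w' \<in> V - set (a # b # zs)" "w \<noteq> w'"
  shows "\<not> E {w, u, w'}"
proof
  assume E: "E {w, u, w'}"
  obtain c zs' where zs: "zs = c # zs'" using assms(1) by (cases zs) auto
  have "lpath E (w # w' # a # b # zs) \<or> lpath E (w # w' # b # a # zs)"
    using E assms(1,6) by (auto simp: zs insert_commute)
  moreover have "\<not> lpath E (w # w' # a # b # zs)" "\<not> lpath E (w # w' # b # a # zs)"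
    using assms(5)[unfolded has_path_def, simplified, rule_format, of "w # w' # a # b # zs"]
      assms(5)[unfolded has_path_def, simplified, rule_format, of "w # w' # b # a # zs"] assms(2-4,7-9)
    by auto
  ultimately show False by blast
qed

text \<open>The \<open>k\<close> detours along a segment \<open>M\<close> give \<open>2 * k\<close>
  blue edges; \<open>s\<close> closing edges use end vertices of \<open>L\<close>, two at the front
  and, if \<open>2 * k + 2 \<le> l\<close>, two at the back. For \<open>k = 0\<close> the blue path
  is a single vertex, which one edge cannot close. The first bound on \<open>card V\<close> is for
  the detours, the second for the vertices of \<open>W\<close> on the cycle.\<close>

lemma has_cycle_of_longest_path:
  assumes V: "finite V" and L: "lpath E L" "distinct L" "set L \<subseteq> V" "length L = 2 * l + 1"
    and max: "\<not> has_path E V (Suc l)"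
    and l: "2 * k + 1 \<le> l" and s: "1 \<le> s" "s \<le> 2 \<or> 2 * k + 2 \<le> l \<and> s \<le> 4" "0 < k \<or> 2 \<le> s"
    and card: "k + 2 + (2 * l + 1) \<le> card V" "k + s + (2 * l + 1) \<le> card V"
  shows "has_cycle (\<lambda>e. \<not> E e) V (2 * k + s)"
proof -
  define W where "W = V - set L"
  have W: "finite W" "card W = card V - (2 * l + 1)" "set L \<inter> W = {}"
    using V L by (auto simp: W_def card_Diff_subset distinct_card)
  have "3 \<le> length L" using L(4) l by simp
  then obtain a b L' where ab: "L = a # b # L'"
    by (auto simp: numeral_eq_Suc Suc_le_length_iff)
  define M where "M = take (4 * k + 1) L'"
  define R where "R = drop (4 * k + 1) L'"
  have LMR: "L = a # b # M @ R" by (simp add: ab M_def R_def)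
  have lenM: "length M = 4 * k + 1" and lenR: "length R + 4 * k + 2 = 2 * l"
    using L(4) l by (auto simp: M_def R_def ab)
  have "rigid E W L"
    unfolding rigid_def
  proof (intro conjI allI impI notI)
    fix L' assume "lpath E L'" "distinct L'" "set L' \<subseteq> set L \<union> W" "length L' = length L + 2"
    then show False
      using max L unfolding has_path_def W_def by auto
  qed (use L W in auto)
  then have "rigid E W ([a, b] @ (M @ R))" by (simp add: LMR)
  then have "rigid E W (M @ R)" by (rule rigid_append) (use lenM in auto)
  then have "rigid E W M" by (rule rigid_prefix) (use lenM in auto)
  then have "linkable (\<lambda>e. \<not> E e) W k (set M)" using lenM by (rule rigid_linkable)
  moreover have "k + 2 \<le> card W" "W \<inter> set M = {}" using card W by (auto simp: LMR)
  ultimately obtain Q where Q: "lpath (\<lambda>e. \<not> E e) Q" "distinct Q" "length Q = 4 * k + 1"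
    "set Q \<subseteq> W \<union> set M" "hd Q \<in> W" "last Q \<in> W" "card (set Q \<inter> W) = k + 1"
    using linkable_lpath[OF _ W(1)] by metis
  have "\<exists>U. U \<subseteq> set L \<and> U \<inter> set M = {} \<and> s \<le> card U \<and>
    (\<forall>u\<in>U. \<forall>w\<in>W. \<forall>w'\<in>W. w \<noteq> w' \<longrightarrow> \<not> E {w, u, w'})"
  proof (cases "s \<le> 2")
    case True
    have "\<forall>u\<in>{a, b}. \<forall>w\<in>W. \<forall>w'\<in>W. w \<noteq> w' \<longrightarrow> \<not> E {w, u, w'}"
      using longest_path_end[of E a b "M @ R" V l] L max unfolding W_def LMR by blast
    moreover have "s \<le> card {a, b}" "{a, b} \<inter> set M = {}" using True L(2) by (auto simp: LMR)
    ultimately show ?thesis by (intro exI[of _ "{a, b}"]) (auto simp: LMR)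
  next
    case False
    then have "2 \<le> length R" using s lenR by simp
    then have "2 \<le> length (rev R)" by simp
    then obtain x y R' where "rev R = y # x # R'"
      by (auto simp del: length_rev simp: numeral_eq_Suc Suc_le_length_iff)
    then have R: "R = rev R' @ [x, y]" by (metis append.assoc append_Cons append_Nil rev_rev_ident rev.simps(2))
    have rev: "rev L = y # x # R' @ rev M @ [b, a]" by (simp add: LMR R)
    have "\<forall>u\<in>{a, b}. \<forall>w\<in>W. \<forall>w'\<in>W. w \<noteq> w' \<longrightarrow> \<not> E {w, u, w'}"
      using longest_path_end[of E a b "M @ R" V l] L max unfolding W_def LMR by blast
    moreover have "\<forall>u\<in>{y, x}. \<forall>w\<in>W. \<forall>w'\<in>W. w \<noteq> w' \<longrightarrow> \<not> E {w, u, w'}"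
    proof -
      have "lpath E (rev L)" "distinct (rev L)" "set (rev L) \<subseteq> V" "length (rev L) = 2 * l + 1" "W = V - set (rev L)"
        using L lpath_rev by (auto simp: W_def)
      then show ?thesis
        using longest_path_end[of E y x "R' @ rev M @ [b, a]" V l] max unfolding rev by blast
    qed
    moreover have "distinct [a, b, x, y]" using L(2) by (auto simp: LMR R)
    then have "s \<le> card {a, b, x, y}" using s False by auto
    moreover have "{a, b, x, y} \<inter> set M = {}" using L(2) by (auto simp: LMR R)
    ultimately show ?thesis by (intro exI[of _ "{a, b, x, y}"]) (auto simp: LMR R)
  qed
  then obtain U where U: "U \<subseteq> set L" "U \<inter> set M = {}" "s \<le> card U"
    "\<And>u w w'. u \<in> U \<Longrightarrow> w \<in> W \<Longrightarrow> w' \<in> W \<Longrightarrow> w \<noteq> w' \<Longrightarrow> \<not> E {w, u, w'}"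
    by blast
  have finU: "finite U" using U(1) finite_subset by blast
  have "W \<inter> U = {}" using U(1) W(3) by blast
  have UQ: "U - set Q = U" using Q(4) U(1,2) W(3) by blast
  have "card (W - set Q) = card W - (k + 1)"
    using Q(7) W(1) by (metis Diff_Int2 Int_commute card_Diff_subset_Int finite_Int inf_commute)
  \<comment> \<open>A zigzag of \<open>s\<close> edges needs only \<open>s - 1\<close> new vertices
    of \<open>W\<close>.\<close>
  then have sW: "s - 1 \<le> card (W - set Q)" using card W by simp
  have hl: "s - 1 = 0 \<longrightarrow> hd Q \<noteq> last Q"
  proof
    assume "s - 1 = 0"
    then have "2 \<le> length Q" using Q(3) s by simp
    then obtain h h' t where "Q = h # h' # t" by (auto simp: numeral_eq_Suc Suc_le_length_iff)
    then show "hd Q \<noteq> last Q" using Q(2) by (auto split: if_splits)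
  qed
  have "s - 1 < card (U - set Q)" using U(3) s UQ by simp
  from lcycle_close[OF Q(1,2,5,6) sW this hl W(1) finU \<open>W \<inter> U = {}\<close> U(4)]
  obtain ys where ys: "lcycle (\<lambda>e. \<not> E e) ys" "distinct ys" "set ys \<subseteq> set Q \<union> W \<union> U"
    "length ys = length Q + 2 * (s - 1) + 1"
    by blast
  have "set Q \<subseteq> V" "set L \<subseteq> V" "W \<subseteq> V" using Q(4) L(3) by (auto simp: LMR W_def)
  then have "set ys \<subseteq> V" using ys(3) U(1) by blast
  moreover have "length ys = 2 * (2 * k + s)" using ys(4) Q(3) s(1) by simp
  ultimately show ?thesis using ys unfolding has_cycle_def by blast
qed

text \<open>The \<open>m div 2\<close> detours around the cycle, of two edges each, are strung
  together to a path of the other colour.\<close>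

lemma has_path_of_longest_cycle:
  assumes V: "finite V" and m: "3 \<le> m" and cyc: "has_cycle E V m" and max: "\<not> has_cycle E V (Suc m)"
    and card: "m div 2 + 2 + 2 * m \<le> card V"
  shows "has_path (\<lambda>e. \<not> E e) V (2 * (m div 2))"
proof -
  obtain ys where ys: "lcycle E ys" "distinct ys" "set ys \<subseteq> V" "length ys = 2 * m"
    using cyc unfolding has_cycle_def by blast
  define W where "W = V - set ys"
  have W: "finite W" "card W = card V - 2 * m" "set ys \<inter> W = {}"
    using V ys by (auto simp: W_def card_Diff_subset distinct_card)
  have "linkable (\<lambda>e. \<not> E e) W (m div 2) (set ys)"
    by (rule lcycle_linkable[OF ys(1,2,4) m W(3)])
      (use max ys(3,4) in \<open>auto simp: has_cycle_def W_def\<close>)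
  moreover have "m div 2 + 2 \<le> card W" "W \<inter> set ys = {}" using card W by auto
  ultimately obtain Q where Q: "lpath (\<lambda>e. \<not> E e) Q" "distinct Q" "length Q = 4 * (m div 2) + 1"
    "set Q \<subseteq> W \<union> set ys"
    using linkable_lpath[OF _ W(1)] by metis
  then show ?thesis
    using ys(3) unfolding has_path_def W_def by (intro exI[of _ Q]) auto
qed

section \<open>The Ramsey number\<close>

text \<open>Three vertices outside a red edge \<open>abc\<close> form with \<open>a\<close>,
  \<open>b\<close>, \<open>c\<close> a 3-cycle whose edges meet \<open>abc\<close> in one vertex
  each; a red one among them extends \<open>abc\<close> to a path.\<close>

lemma has_path_2_or_cycle_3:
  assumes V: "finite V" "8 \<le> card V"
  shows "has_path E V 2 \<or> has_cycle (\<lambda>e. \<not> E e) V 3"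
proof (cases "\<exists>a b c. distinct [a, b, c] \<and> {a, b, c} \<subseteq> V \<and> E {a, b, c}")
  case True
  then obtain a b c where abc: "distinct [a, b, c]" "{a, b, c} \<subseteq> V" "E {a, b, c}" by blast
  have "card {a, b, c} = 3" using abc(1) by simp
  then have "3 \<le> card (V - {a, b, c})"
    using V abc(2) by (simp add: card_Diff_subset)
  then obtain S where S: "S \<subseteq> V - {a, b, c}" "card S = 3"
    by (meson obtain_subset_with_card_n)
  then obtain p q r where "S = {p, q, r}" "p \<noteq> q" "q \<noteq> r" "p \<noteq> r"
    by (auto simp: card_3_iff)
  then have pqr: "distinct [p, q, r]" "{p, q, r} \<inter> {a, b, c} = {}" "{p, q, r} \<subseteq> V"
    using S by auto
  show ?thesis
  proof (rule disjCI)
    assume no: "\<not> has_cycle (\<lambda>e. \<not> E e) V 3"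
    have "distinct [p, a, q, b, r, c]" "set [p, a, q, b, r, c] \<subseteq> V" using abc pqr by auto
    then have "has_cycle (\<lambda>e. \<not> E e) V 3" if "lcycle (\<lambda>e. \<not> E e) [p, a, q, b, r, c]"
      using that unfolding has_cycle_def by (intro exI[of _ "[p, a, q, b, r, c]"]) auto
    then have "\<not> lcycle (\<lambda>e. \<not> E e) [p, a, q, b, r, c]"
      using no by blast
    then have "E {p, a, q} \<or> E {q, b, r} \<or> E {r, c, p}"
      by (auto simp: lcycle_def)
    then have "lpath E [b, c, a, p, q] \<or> lpath E [a, c, b, q, r] \<or> lpath E [a, b, c, r, p]"
      using abc(3) by (auto simp: insert_commute)
    moreover have "distinct [b, c, a, p, q]" "distinct [a, c, b, q, r]" "distinct [a, b, c, r, p]"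
      "set [b, c, a, p, q] \<subseteq> V" "set [a, c, b, q, r] \<subseteq> V" "set [a, b, c, r, p] \<subseteq> V"
      using abc pqr by auto
    ultimately obtain xs where "xs \<in> {[b, c, a, p, q], [a, c, b, q, r], [a, b, c, r, p]}"
      "lpath E xs" "distinct xs" "set xs \<subseteq> V" by blast
    then show "has_path E V 2"
      unfolding has_path_def by (intro exI[of _ xs]) auto
  qed
next
  case False
  obtain S where S: "S \<subseteq> V" "card S = 6" "finite S"
    using V obtain_subset_with_card_n[of 6 V] by auto
  then obtain ys where ys: "set ys = S" "distinct ys" "length ys = 6"
    by (metis distinct_card finite_distinct_list)
  then obtain p q r s t u where "ys = [p, q, r, s, t, u]"
    by (auto simp: numeral_eq_Suc length_Suc_conv)
  then have "lcycle (\<lambda>e. \<not> E e) ys"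
    using False ys S(1) by (auto simp: lcycle_def)
  then show ?thesis
    using ys S unfolding has_cycle_def by (intro disjI2 exI[of _ ys]) auto
qed

lemma has_path_or_cycle_step:
  assumes V: "finite V" and m: "3 \<le> m" "m \<le> n" and card: "2 * n + (m + 1) div 2 \<le> card V"
    and path: "has_path E V (n - 1)"
  shows "has_path E V n \<or> has_cycle (\<lambda>e. \<not> E e) V m"
proof (unfold disj_imp, rule impI)
  assume "\<not> has_path E V n"
  then have max: "\<not> has_path E V (Suc (n - 1))" using m by simp
  obtain L where L: "lpath E L" "distinct L" "set L \<subseteq> V" "length L = 2 * (n - 1) + 1"
    using path unfolding has_path_def by blast
  note cycle = has_cycle_of_longest_path[OF V L max]
  \<comment> \<open>The values of \<open>(k, s)\<close> are \<open>(t - 1, 2)\<close>,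
    \<open>(t, 1)\<close> and \<open>(t - 1, 3)\<close>. For odd \<open>m = n\<close> the red path
    is too short for \<open>k = t\<close>, so one detour is traded for two closing edges and both
    ends are used.\<close>
  consider (even) t where "m = 2 * t" | (odd) t where "m = 2 * t + 1" "m < n" | (eq) t where "m = 2 * t + 1" "m = n"
    using m(2) by (metis evenE le_neq_implies_less oddE)
  then show "has_cycle (\<lambda>e. \<not> E e) V m"
  proof cases
    case even
    have "has_cycle (\<lambda>e. \<not> E e) V (2 * (t - 1) + 2)"
      using m card even by (intro cycle) auto
    moreover have "2 * (t - 1) + 2 = m" using m even by simp
    ultimately show ?thesis by simp
  next
    case odd
    have "has_cycle (\<lambda>e. \<not> E e) V (2 * t + 1)"
      using m card odd by (intro cycle) auto
    then show ?thesis using odd by simp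
  next
    case eq
    have "has_cycle (\<lambda>e. \<not> E e) V (2 * (t - 1) + 3)"
      using m card eq by (intro cycle) auto
    moreover have "2 * (t - 1) + 3 = m" using m eq by simp
    ultimately show ?thesis by simp
  qed
qed

lemma has_path_or_cycle:
  assumes V: "finite V" and "3 \<le> m" "m \<le> n" "2 * n + (m + 1) div 2 \<le> card V"
  shows "has_path E V n \<or> has_cycle (\<lambda>e. \<not> E e) V m"
  using assms(2-)
proof (induction "n + m" arbitrary: n m rule: less_induct)
  case less
  note step = has_path_or_cycle_step[OF V less.prems]
  consider "m < n" | "n = m" "m = 3" | "n = m" "4 \<le> m" using less.prems by linarith
  then show ?case
  proof cases
    case 1
    then have "has_path E V (n - 1) \<or> has_cycle (\<lambda>e. \<not> E e) V m"
      using less.prems by (intro less.hyps) auto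
    then show ?thesis using step by blast
  next
    case 2
    then have "has_path E V 2 \<or> has_cycle (\<lambda>e. \<not> E e) V 3"
      using less.prems V by (intro has_path_2_or_cycle_3) auto
    then show ?thesis using step 2 by auto
  next
    case 3
    have "has_path E V (n - 1) \<or> has_cycle (\<lambda>e. \<not> E e) V (m - 1)"
    proof -
      have "2 * (m - 1) + (m - 1 + 1) div 2 \<le> card V" using less.prems 3 by linarith
      then have "has_path E V (m - 1) \<or> has_cycle (\<lambda>e. \<not> E e) V (m - 1)"
        using 3 by (intro less.hyps) auto
      then show ?thesis using 3 by simp
    qed
    moreover have ?thesis
      if "has_cycle (\<lambda>e. \<not> E e) V (m - 1)" "\<not> has_path E V (n - 1)" "\<not> has_cycle (\<lambda>e. \<not> E e) V m"
    proof -
      have "(m - 1) div 2 + 2 + 2 * (m - 1) \<le> card V" using less.prems 3 by linarith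
      then have path: "has_path E V (2 * ((m - 1) div 2))"
        using has_path_of_longest_cycle[OF V _ that(1)] that(3) 3 by simp
      show ?thesis
      proof (cases "odd m")
        case True
        then have "2 * ((m - 1) div 2) = n - 1" using 3 by simp
        then show ?thesis using path that by simp
      next
        case False
        then obtain t where t: "m = 2 * t" "2 \<le> t" using 3 by auto
        then have "2 * ((m - 1) div 2) = m - 2" by presburger
        then obtain L where L: "lpath E L" "distinct L" "set L \<subseteq> V" "length L = 2 * (m - 2) + 1"
          using path unfolding has_path_def by auto
        \<comment> \<open>A red path with \<open>n - 1\<close> edges is excluded, so this one is
          longest; all four end vertices are used, with \<open>k = t - 2\<close> and
          \<open>s = 4\<close>.\<close>
        have "Suc (m - 2) = n - 1" using 3 by simp
        then have "has_cycle (\<lambda>e. \<not> E e) V (2 * (t - 2) + 4)"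
          using that(2) 3 t less.prems by (intro has_cycle_of_longest_path[OF V L]) auto
        moreover have "2 * (t - 2) + 4 = m" using t by simp
        ultimately show ?thesis by simp
      qed
    qed
    ultimately show ?thesis using step by blast
  qed
qed

section \<open>From vertex lists to copies in a colour class\<close>

lemma contains_copy_colour_class:
  assumes "uniform3 H" "inj_on f (verts H)" "f ` verts H \<subseteq> {..<N}" "\<And>e. e \<in> edges H \<Longrightarrow> c (f ` e) = k"
  shows "contains_copy (colour_class c k (complete3 N)) H"
proof -
  have "f ` e \<in> [{..<N}]\<^bsup>3\<^esup>" if "e \<in> edges H" for e
  proof -
    have e: "e \<subseteq> verts H" "finite e" "card e = 3"
      using assms(1) that by (auto simp: uniform3_def nsets_def)
    then have "inj_on f e" using assms(2) inj_on_subset by blast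
    then show ?thesis using e assms(3) by (auto simp: nsets_def card_image)
  qed
  then show ?thesis
    using assms unfolding contains_copy_def colour_class_def complete3_def by (intro exI[of _ f]) auto
qed

lemma contains_copy_loose_path:
  assumes "has_path (\<lambda>e. c e = k) {..<N} n"
  shows "contains_copy (colour_class c k (complete3 N)) (loose_path n)"
proof -
  obtain xs where xs: "lpath (\<lambda>e. c e = k) xs" "distinct xs" "set xs \<subseteq> {..<N}" "length xs = 2 * n + 1"
    using assms unfolding has_path_def by blast
  show ?thesis
  proof (rule contains_copy_colour_class[OF uniform3_loose_path, where f = "\<lambda>i. xs ! (i - 1)"])
    show "inj_on (\<lambda>i. xs ! (i - 1)) (verts (loose_path n))"
      using xs by (auto simp: inj_on_def loose_path_def nth_eq_iff_index_eq)
    show "(\<lambda>i. xs ! (i - 1)) ` verts (loose_path n) \<subseteq> {..<N}"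
    proof (rule image_subsetI)
      fix j assume "j \<in> verts (loose_path n)"
      then have "xs ! (j - 1) \<in> set xs"
        using xs(4) by (intro nth_mem) (auto simp: loose_path_def)
      then show "xs ! (j - 1) \<in> {..<N}" using xs(3) by blast
    qed
  next
    fix e assume "e \<in> edges (loose_path n)"
    then obtain i where i: "i < n" "e = {2*i+1, 2*i+2, 2*i+3}"
      by (auto simp: loose_path_def)
    have "(\<lambda>i. xs ! (i - 1)) ` e = {xs ! (2*i), xs ! (2*i+1), xs ! (2*i+2)}"
      by (simp add: i(2))
    then show "c ((\<lambda>i. xs ! (i - 1)) ` e) = k"
      using lpath_nth[OF xs(1), of i] i(1) xs(4) by simp
  qed
qed

lemma contains_copy_loose_cycle:
  assumes "has_cycle (\<lambda>e. c e = k) {..<N} m" "2 \<le> m"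
  shows "contains_copy (colour_class c k (complete3 N)) (loose_cycle m)"
proof -
  obtain ys where ys: "lcycle (\<lambda>e. c e = k) ys" "distinct ys" "set ys \<subseteq> {..<N}" "length ys = 2 * m"
    using assms unfolding has_cycle_def by blast
  \<comment> \<open>The residue 0 stands for the vertex numbered \<open>2 * m\<close>, hence for the
    last entry of \<open>ys\<close>.\<close>
  define f where "f j = ys ! (if j = 0 then 2 * m - 1 else j - 1)" for j
  have lt: "(if j = 0 then 2 * m - 1 else j - 1) < length ys" if "j < 2 * m" for j
    using that ys(4) by auto
  show ?thesis
  proof (rule contains_copy_colour_class[OF uniform3_loose_cycle, where f = f])
    show "inj_on f (verts (loose_cycle m))"
      using ys(2) lt by (auto simp: inj_on_def loose_cycle_def f_def nth_eq_iff_index_eq split: if_splits)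
    have "f j \<in> set ys" if "j < 2 * m" for j
      unfolding f_def using lt[OF that] by (rule nth_mem)
    then show "f ` verts (loose_cycle m) \<subseteq> {..<N}"
      using ys(3) by (auto simp: loose_cycle_def)
  next
    fix e assume "e \<in> edges (loose_cycle m)"
    then obtain i where i: "i < m" "e = {(2*i+1) mod (2*m), (2*i+2) mod (2*m), (2*i+3) mod (2*m)}"
      by (auto simp: loose_cycle_def)
    have E: "c {(ys @ [hd ys]) ! (2*i), (ys @ [hd ys]) ! (2*i+1), (ys @ [hd ys]) ! (2*i+2)} = k"
      using ys(1,4) i(1) unfolding lcycle_def
      by (intro lpath_nth[where E = "\<lambda>e. c e = k"]) auto
    show "c (f ` e) = k"
    proof (cases "i = m - 1")
      case True
      then have i': "2*i+1 = 2*m-1" "2*i+2 = 2*m" "2*i+3 = Suc (2*m)" "2*i = 2*m-2"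
        using assms(2) by auto
      have "(2*i+1) mod (2*m) = 2*m-1" "(2*i+2) mod (2*m) = 0" "(2*i+3) mod (2*m) = 1"
        unfolding i'(1-3) using assms(2) by (simp_all add: mod_Suc)
      then have "e = {2*m-1, 0, 1}" by (simp only: i(2))
      moreover have "f (2*m-1) = ys ! (2*m-2)" "f 0 = ys ! (2*m-1)" "f 1 = ys ! 0"
        using assms(2) by (simp_all add: f_def flip: numeral_2_eq_2)
      ultimately have "f ` e = {ys ! (2*m-2), ys ! (2*m-1), ys ! 0}"
        by (simp only: image_insert image_empty)
      moreover have "ys \<noteq> []" using ys(4) assms(2) by auto
      then have "(ys @ [hd ys]) ! (2*i+1) = ys ! (2*m-1)" "(ys @ [hd ys]) ! (2*i+2) = ys ! 0"
        using ys(4) assms(2) unfolding i'(1,2) by (simp_all add: nth_append hd_conv_nth)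
      moreover have "(ys @ [hd ys]) ! (2*i) = ys ! (2*m-2)"
        using ys(4) assms(2) unfolding i'(4) by (simp add: nth_append)
      ultimately show ?thesis using E by simp
    next
      case False
      then have lt: "2 * i + 3 < 2 * m" using i(1) by simp
      then have "f ` e = {ys ! (2*i), ys ! (2*i+1), ys ! (2*i+2)}"
        unfolding i(2) by (simp add: f_def)
      then show ?thesis using E lt ys(4) by (simp add: nth_append)
    qed
  qed (use assms in simp)
qed

lemma arrows_upper:
  assumes "3 \<le> m" "m \<le> n"
  shows "arrows (2 * n + (m + 1) div 2) (loose_path n) (loose_cycle m)"
  unfolding arrows_def
proof
  fix c :: "nat set \<Rightarrow> colour"
  let ?N = "2 * n + (m + 1) div 2"
  have "(\<lambda>e. \<not> c e = Red) = (\<lambda>e. c e = Blue)"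
    by (metis (full_types) colour.distinct(1) colour.exhaust)
  then have "has_path (\<lambda>e. c e = Red) {..<?N} n \<or> has_cycle (\<lambda>e. c e = Blue) {..<?N} m"
    using has_path_or_cycle[of "{..<?N}" m n "\<lambda>e. c e = Red"] assms by simp
  then show "contains_copy (colour_class c Red (complete3 ?N)) (loose_path n) \<or>
      contains_copy (colour_class c Blue (complete3 ?N)) (loose_cycle m)"
    using contains_copy_loose_path contains_copy_loose_cycle assms by force
qed

section \<open>The lower bound\<close>

lemma arrows_lower:
  assumes "1 \<le> m" "1 \<le> n" and arr: "arrows N (loose_path n) (loose_cycle m)"
  shows "2 * n + (m + 1) div 2 \<le> N"
proof (rule ccontr)
  assume less: "\<not> 2 * n + (m + 1) div 2 \<le> N"
  define c where "c e = (if e \<subseteq> {..<2*n} then Red else Blue)" for e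
  have "contains_copy (colour_class c Red (complete3 N)) (loose_path n) \<or>
      contains_copy (colour_class c Blue (complete3 N)) (loose_cycle m)"
    using arr unfolding arrows_def by blast
  then show False
  proof
    assume "contains_copy (colour_class c Red (complete3 N)) (loose_path n)"
    then obtain f where f: "inj_on f {1..2*n+1}"
      "\<And>i. i < n \<Longrightarrow> c (f ` {2*i+1, 2*i+2, 2*i+3}) = Red"
      unfolding contains_copy_def colour_class_def loose_path_def by auto
    have "f j < 2 * n" if j: "j \<in> {1..2*n+1}" for j
    proof -
      \<comment> \<open>The last vertex lies only on the edge numbered \<open>n - 1\<close>, while
        \<open>(j - 1) div 2\<close> would be \<open>n\<close>.\<close>
      define i where "i = (if j = 2*n+1 then n - 1 else (j - 1) div 2)"
      have "i < n" "j \<in> {2*i+1, 2*i+2, 2*i+3}"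
        using j assms(2) by (auto simp: i_def)
      then show ?thesis using f(2)[of i] by (auto simp: c_def split: if_splits)
    qed
    then have "card {1..2*n+1} \<le> card {..<2*n}"
      using f(1) by (intro card_inj_on_le[of f]) auto
    then show False by simp
  next
    assume "contains_copy (colour_class c Blue (complete3 N)) (loose_cycle m)"
    then obtain f where f: "inj_on f {..<2*m}" "f ` {..<2*m} \<subseteq> {..<N}"
      "\<And>i. i < m \<Longrightarrow> c (f ` {(2*i+1) mod (2*m), (2*i+2) mod (2*m), (2*i+3) mod (2*m)}) = Blue"
      unfolding contains_copy_def colour_class_def loose_cycle_def complete3_def by auto
    define T where "T = {v. v < 2 * m \<and> 2 * n \<le> f v}"
    have "card T \<le> card {2*n..<N}"
      using f(1,2) by (intro card_inj_on_le[of f]) (auto simp: T_def intro: inj_on_subset)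
    moreover have "2 * (N - 2 * n) < m" using less assms(1) by presburger
    ultimately have T: "finite T" "2 * card T < m" by (auto simp: T_def)
    \<comment> \<open>Every blue edge meets \<open>T\<close>, and \<open>v\<close> lies at most on
      the edge numbered \<open>v div 2\<close> and its cyclic predecessor; hence
      \<open>m \<le> 2 * card T\<close>.\<close>
    have "\<exists>v\<in>T. i \<in> {v div 2, (v div 2 + m - 1) mod m}" if i: "i < m" for i
    proof -
      obtain v where v: "v \<in> {(2*i+1) mod (2*m), (2*i+2) mod (2*m), (2*i+3) mod (2*m)}" "2 * n \<le> f v"
        using f(3)[OF i] by (force simp: c_def not_less split: if_splits)
      have "v \<in> T" using v assms(1) by (auto simp: T_def)
      have "i = v div 2 \<or> i = (v div 2 + m - 1) mod m"
      proof (cases "i = m - 1")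
        case True
        then have i': "2*i+1 = 2*m-1" "2*i+2 = 2*m" "2*i+3 = Suc (2*m)"
          using assms(1) by auto
        have "v = 2*i+1 \<or> v div 2 = 0"
          using v(1) assms(1) unfolding i' by (auto simp: mod_Suc)
        then show ?thesis using True assms(1) by auto
      next
        case False
        then have "2 * i + 3 < 2 * m" using i by simp
        then have "v = 2*i+1 \<or> v = 2*i+2 \<or> v = 2*i+3" using v(1) by auto
        moreover have "(i + 1 + m - 1) mod m = i" using i by simp
        ultimately show ?thesis by auto
      qed
      then show ?thesis using \<open>v \<in> T\<close> by blast
    qed
    then have "{..<m} \<subseteq> (\<Union>v\<in>T. {v div 2, (v div 2 + m - 1) mod m})" by blast
    then have "m \<le> card (\<Union>v\<in>T. {v div 2, (v div 2 + m - 1) mod m})"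
      using card_mono[of "\<Union>v\<in>T. {v div 2, (v div 2 + m - 1) mod m}" "{..<m}"] T(1) by simp
    also have "\<dots> \<le> (\<Sum>v\<in>T. card {v div 2, (v div 2 + m - 1) mod m})"
      using T(1) by (rule card_UN_le)
    also have "\<dots> \<le> (\<Sum>v\<in>T. 2)"
      by (intro sum_mono) (simp add: card_insert_if)
    also have "\<dots> = 2 * card T" by simp
    finally show False using T(2) by simp
  qed
qed

theorem theorem5p1:
  fixes n m :: nat
  assumes "n \<ge> m" and "m \<ge> 3"
  shows "ramsey_number (loose_path n) (loose_cycle m) = 2 * n + (m + 1) div 2"
  unfolding ramsey_number_def
  using assms by (intro Least_equality arrows_upper arrows_lower) auto

end
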